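(* Let $A$ be a Dedekind hypermultipermutational left brace. If the additive group of the socle $\operatorname{Soc}(A)$ is torsion-free, then $A$ is abelian.
   Context: A left brace is a triple $(A,+,\cdot)$ such that $(A,+)$ is an abelian group, $(A,\cdot)$ is a group, and $a\cdot(b+c)=a\cdot b+a\cdot c-a$ for all $a,b,c\in A$. The two groups have the same identity $0$. The star operation is $a\ast b=ab-a-b$. $A$ is abelian if $a\ast b=0$ for all $a,b\in A$. A non-empty subset is a subbrace if it is a subgroup for both operations; a subbrace $I$ is an ideal of $A$ if $a\ast x, x\ast a\in I$ for all $a\in A$, $x\in I$ (then $A/I$ is a left brace). $A$ is Dedekind if every subbrace of $A$ is an ideal of $A$. The socle is the ideal $\operatorname{Soc}(A)=\{a\in A\mid a\ast x=0 \text{ for all } x\in A\}$. The socle series is the ascending ordinal series of ideals defined by $\operatorname{Soc}_0(A)=0$, $\operatorname{Soc}_{\alpha+1}(A)/\operatorname{Soc}_\alpha(A)=\operatorname{Soc}(A/\operatorname{Soc}_\alpha(A))$ for every ordinal $\alpha$, and $\operatorname{Soc}_\lambda(A)=\bigcup_{\mu<\lambda}\operatorname{Soc}_\mu(A)$ for every limit ordinal $\lambda$. The last term of this series is denoted $\operatorname{Soc}_\infty(A)$, and $A$ is hypermultipermutational if $\operatorname{Soc}_\infty(A)=A$. *)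

theory Defs
  imports "HOL-Algebra.Algebra"
begin

section \<open>Left braces\<close>

text \<open>
  Both operations live in one ring record: \<open>\<oplus>\<close>, \<open>\<zero>\<close> is the additive group and \<open>\<otimes>\<close>, \<open>\<one>\<close> the
  multiplicative group. That \<open>\<one> = \<zero>\<close> is a consequence of the axioms.
\<close>

locale left_brace = abelian_group A + group A for A (structure) +
  assumes brace_distrib:
    "\<lbrakk>a \<in> carrier A; b \<in> carrier A; c \<in> carrier A\<rbrakk>
      \<Longrightarrow> a \<otimes> (b \<oplus> c) = a \<otimes> b \<oplus> a \<otimes> c \<ominus> a"

lemma (in left_brace) one_eq_zero: "\<one> = \<zero>"
proof -
  have "\<one> \<otimes> (\<zero> \<oplus> \<zero>) = \<one> \<otimes> \<zero> \<oplus> \<one> \<otimes> \<zero> \<ominus> \<one>"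
    by (rule brace_distrib) simp_all
  then have "\<ominus> \<one> = \<zero>"
    by (simp add: a_minus_def)
  then show ?thesis
    using r_neg[of \<one>] by simp
qed

definition star :: "('a, 'm) ring_scheme \<Rightarrow> 'a \<Rightarrow> 'a \<Rightarrow> 'a" where
  "star A a b = a \<otimes>\<^bsub>A\<^esub> b \<ominus>\<^bsub>A\<^esub> a \<ominus>\<^bsub>A\<^esub> b"

definition abelian_brace :: "('a, 'm) ring_scheme \<Rightarrow> bool" where
  "abelian_brace A \<longleftrightarrow> (\<forall>a\<in>carrier A. \<forall>b\<in>carrier A. star A a b = \<zero>\<^bsub>A\<^esub>)"

definition subbrace :: "'a set \<Rightarrow> ('a, 'm) ring_scheme \<Rightarrow> bool" where
  "subbrace S A \<longleftrightarrow> subgroup S (add_monoid A) \<and> subgroup S A"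

definition brace_ideal :: "'a set \<Rightarrow> ('a, 'm) ring_scheme \<Rightarrow> bool" where
  "brace_ideal I A \<longleftrightarrow> subbrace I A \<and>
    (\<forall>a\<in>carrier A. \<forall>x\<in>I. star A a x \<in> I \<and> star A x a \<in> I)"

definition dedekind_brace :: "('a, 'm) ring_scheme \<Rightarrow> bool" where
  "dedekind_brace A \<longleftrightarrow> (\<forall>S. subbrace S A \<longrightarrow> brace_ideal S A)"


section \<open>The socle series\<close>

definition socle :: "('a, 'm) ring_scheme \<Rightarrow> 'a set" where
  "socle A = {a \<in> carrier A. \<forall>x\<in>carrier A. star A a x = \<zero>\<^bsub>A\<^esub>}"

text \<open>
  \<open>A Quot I\<close> carries the additive cosets of \<open>I\<close> with the operations induced by representatives. For
  an ideal \<open>I\<close> of a brace the additive and multiplicative cosets coincide, so this is the quotient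
  brace. \<open>socle_step A I\<close> is the preimage of \<open>Soc(A/I)\<close> in \<open>A\<close>, that is, the \<open>J\<close> with
  \<open>J/I = Soc(A/I)\<close>.
\<close>

definition socle_step :: "('a, 'm) ring_scheme \<Rightarrow> 'a set \<Rightarrow> 'a set" where
  "socle_step A I = {a \<in> carrier A. I +>\<^bsub>A\<^esub> a \<in> socle (A Quot I)}"

text \<open>
  The ordinals indexing the series are the elements of (the field of) a well-order \<open>r\<close>.
\<close>

definition socle_series :: "('a, 'm) ring_scheme \<Rightarrow> 'i rel \<Rightarrow> 'i \<Rightarrow> 'a set" where
  "socle_series A r =
    wo_rel.worecZSL r {\<zero>\<^bsub>A\<^esub>} (\<lambda>_ I. socle_step A I) (\<lambda>S l. \<Union>m\<in>underS r l. S m)"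

lemma
  fixes A :: "('a, 'm) ring_scheme" and r :: "'i rel"
  assumes "Well_order r"
  shows socle_series_zero: "socle_series A r (wo_rel.zero r) = {\<zero>\<^bsub>A\<^esub>}"
    and socle_series_succ: "aboveS r i \<noteq> {} \<Longrightarrow>
      socle_series A r (wo_rel.succ r i) = socle_step A (socle_series A r i)"
    and socle_series_lim: "wo_rel.isLim r l \<Longrightarrow> l \<noteq> wo_rel.zero r \<Longrightarrow>
      socle_series A r l = (\<Union>m\<in>underS r l. socle_series A r m)"
proof -
  interpret wo_rel r by (simp add: wo_rel_def assms)
  have adm: "adm_woL (\<lambda>(S :: 'i \<Rightarrow> 'a set) l. \<Union>m\<in>underS l. S m)"
    by (auto simp: adm_woL_def)
  show "socle_series A r zero = {\<zero>\<^bsub>A\<^esub>}"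
    unfolding socle_series_def by (rule worecZSL_zero[OF adm])
  show "aboveS i \<noteq> {} \<Longrightarrow>
      socle_series A r (succ i) = socle_step A (socle_series A r i)"
    unfolding socle_series_def by (rule worecZSL_succ[OF adm])
  show "isLim l \<Longrightarrow> l \<noteq> zero \<Longrightarrow>
      socle_series A r l = (\<Union>m\<in>underS l. socle_series A r m)"
    unfolding socle_series_def by (rule worecZSL_isLim[OF adm])
qed

text \<open>
  The series is an ascending chain of subsets of \<open>A\<close>, so it is stationary from some ordinal below
  the successor cardinal of \<open>|A|\<close> on. Its last term is therefore the union of the terms with index
  below that cardinal.
\<close>

definition socle_infty :: "('a, 'm) ring_scheme \<Rightarrow> 'a set" where
  "socle_infty A =
    (let \<kappa> = cardSuc (card_of (carrier A)) in \<Union>\<alpha>\<in>Field \<kappa>. socle_series A \<kappa> \<alpha>)"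

definition hypermultipermutational :: "('a, 'm) ring_scheme \<Rightarrow> bool" where
  "hypermultipermutational A \<longleftrightarrow> socle_infty A = carrier A"


section \<open>Torsion-free groups\<close>

definition torsion_free :: "('a, 'm) monoid_scheme \<Rightarrow> bool" where
  "torsion_free G \<longleftrightarrow>
    (\<forall>x\<in>carrier G. \<forall>n::nat. n > 0 \<longrightarrow> x [^]\<^bsub>G\<^esub> n = \<one>\<^bsub>G\<^esub> \<longrightarrow> x = \<one>\<^bsub>G\<^esub>)"

end

theory Submission
  imports Defs
begin

text \<open>
  Write \<open>\<lambda>\<^sub>a b = a \<otimes> b \<ominus> a\<close>, so that \<open>\<lambda>\<close> is an action of the multiplicative group by automorphisms
  of the additive group, \<open>a * b = \<lambda>\<^sub>a b \<ominus> b\<close>, and the socle \<open>S\<close> is the kernel of the action. The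
  theorem holds because the second term \<open>T\<close> of the socle series is already equal to \<open>S\<close>
  (\<open>second_socle_eq_socle\<close>): then the series never leaves \<open>S\<close>, and a brace that is exhausted by its
  socle series is its own socle, which means that all star products vanish.

  On \<open>S\<close> the two operations agree, so every additive subgroup of \<open>S\<close> is a subbrace, hence an ideal.
  Thus each \<open>\<lambda>\<^sub>a\<close> maps every cyclic subgroup of the torsion-free group \<open>S\<close> to itself and sends
  each \<open>x\<close> in \<open>S\<close> to \<open>x\<close> or \<open>\<ominus> x\<close> (\<open>lam_socle_right\<close>).

  Let \<open>a\<close> be in \<open>T\<close> and \<open>s = a * a\<close>, an element of \<open>S\<close>. On \<open>T\<close> the action is also additive,
  \<open>\<lambda>\<^sub>x\<^sub>\<oplus>\<^sub>y = \<lambda>\<^sub>x \<circ> \<lambda>\<^sub>y\<close>, because \<open>x \<otimes> y\<close> and \<open>x \<oplus> y\<close> differ by an element of \<open>S\<close>. It follows that the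
  integer span of \<open>a\<close> and \<open>s\<close> is a subbrace, hence an ideal, so it contains \<open>a * b\<close> for
  every \<open>b\<close>. The heart of the proof is the sharper fact that \<open>a * b\<close> is an integer multiple of \<open>s\<close>
  (\<open>star_multiple_of_star_self\<close>). Apply it to \<open>c = n a\<close> in place of \<open>a\<close>, with \<open>n \<ge> 2\<close>: as
  \<open>c * c = n (c * a)\<close>, the element \<open>c * a\<close> of \<open>S\<close> is a multiple of \<open>n (c * a)\<close>, and torsion-freeness
  forces \<open>c * a = 0\<close>, that is, the \<open>n\<close>-th power of \<open>\<lambda>\<^sub>a\<close> fixes \<open>a\<close>. Taking \<open>n = 2\<close> and \<open>n = 3\<close>, \<open>\<lambda>\<^sub>a\<close>
  itself fixes \<open>a\<close>, so \<open>s = 0\<close>; then all \<open>a * b\<close> vanish, and \<open>a\<close> is in \<open>S\<close>.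
\<close>

section \<open>The lambda action\<close>

context left_brace
begin

definition lam :: "'a \<Rightarrow> 'a \<Rightarrow> 'a" where
  "lam a b = a \<otimes> b \<ominus> a"

lemma lam_closed [simp, intro]:
  "\<lbrakk>a \<in> carrier A; b \<in> carrier A\<rbrakk> \<Longrightarrow> lam a b \<in> carrier A"
  by (simp add: lam_def)

lemma star_eq_lam: "star A a b = lam a b \<ominus> b"
  by (simp add: star_def lam_def)

lemma star_closed [simp, intro]:
  "\<lbrakk>a \<in> carrier A; b \<in> carrier A\<rbrakk> \<Longrightarrow> star A a b \<in> carrier A"
  by (simp add: star_eq_lam)

lemma lam_eq_add_star:
  "\<lbrakk>a \<in> carrier A; b \<in> carrier A\<rbrakk> \<Longrightarrow> lam a b = b \<oplus> star A a b"
  by (simp add: star_eq_lam a_minus_def a_ac r_neg r_neg1 r_neg2)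

lemma star_eq_zero_iff:
  "\<lbrakk>a \<in> carrier A; b \<in> carrier A\<rbrakk> \<Longrightarrow> star A a b = \<zero> \<longleftrightarrow> lam a b = b"
  by (metis add.r_cancel_one lam_eq_add_star star_closed a_comm)

lemma mult_eq_add_lam:
  "\<lbrakk>a \<in> carrier A; b \<in> carrier A\<rbrakk> \<Longrightarrow> a \<otimes> b = a \<oplus> lam a b"
  by (simp add: lam_def a_minus_def a_ac r_neg r_neg1 r_neg2)

lemma lam_add:
  "\<lbrakk>a \<in> carrier A; b \<in> carrier A; c \<in> carrier A\<rbrakk> \<Longrightarrow> lam a (b \<oplus> c) = lam a b \<oplus> lam a c"
  by (simp add: lam_def brace_distrib a_minus_def a_ac)

text \<open>
  By associativity of the multiplication, adding either side to \<open>a \<otimes> b\<close> gives \<open>a \<otimes> b \<otimes> c\<close>.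
\<close>

lemma lam_mult:
  assumes "a \<in> carrier A" "b \<in> carrier A" "c \<in> carrier A"
  shows "lam (a \<otimes> b) c = lam a (lam b c)"
proof -
  have "a \<otimes> b \<oplus> lam (a \<otimes> b) c = a \<otimes> (b \<otimes> c)"
    using assms by (simp add: m_assoc flip: mult_eq_add_lam)
  also have "\<dots> = a \<oplus> lam a (b \<oplus> lam b c)"
    using assms by (simp add: mult_eq_add_lam)
  also have "\<dots> = a \<otimes> b \<oplus> lam a (lam b c)"
    using assms by (simp add: lam_add mult_eq_add_lam a_assoc)
  finally show ?thesis
    using assms by simp
qed

lemma lam_zero_left [simp]:
  assumes "b \<in> carrier A"
  shows "lam \<zero> b = b"
proof -
  have "lam \<zero> b = \<one> \<otimes> b \<ominus> \<zero>"
    by (simp only: lam_def one_eq_zero)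
  then show ?thesis
    using assms by (simp add: a_minus_def)
qed

lemma lam_inv_cancel [simp]:
  assumes "a \<in> carrier A" "b \<in> carrier A"
  shows "lam (inv a) (lam a b) = b" "lam a (lam (inv a) b) = b"
  using assms by (simp_all add: one_eq_zero flip: lam_mult)

lemma lam_hom: "a \<in> carrier A \<Longrightarrow> lam a \<in> hom (add_monoid A) (add_monoid A)"
  by (auto simp: hom_def lam_add)

lemma lam_group_hom: "a \<in> carrier A \<Longrightarrow> group_hom (add_monoid A) (add_monoid A) (lam a)"
  by (simp add: group_hom_def group_hom_axioms_def lam_hom a_group)

lemma lam_zero [simp]: "a \<in> carrier A \<Longrightarrow> lam a \<zero> = \<zero>"
  using group_hom.hom_one[OF lam_group_hom] by simp

lemma lam_minus: "\<lbrakk>a \<in> carrier A; b \<in> carrier A\<rbrakk> \<Longrightarrow> lam a (\<ominus> b) = \<ominus> lam a b"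
  using group_hom.hom_inv[OF lam_group_hom] by (simp add: a_inv_def)

lemma int_mult_zero [simp]: "[(0::int)] \<cdot> x = \<zero>"
  by (simp add: add_pow_def)

lemma lam_int_mult:
  "\<lbrakk>a \<in> carrier A; b \<in> carrier A\<rbrakk> \<Longrightarrow> lam a ([(k::int)] \<cdot> b) = [k] \<cdot> lam a b"
  using group_hom.hom_int_pow[OF lam_group_hom] by (simp add: add_pow_def)

lemma star_int_mult:
  "\<lbrakk>a \<in> carrier A; b \<in> carrier A\<rbrakk> \<Longrightarrow> star A a ([(k::int)] \<cdot> b) = [k] \<cdot> star A a b"
  by (simp add: star_eq_lam lam_int_mult a_minus_def add.int_pow_distrib add.int_pow_inv)

text \<open>
  The common identity is \<open>\<zero>\<close>, so both equations are inverse laws of the multiplicative group, with the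
  product written as \<open>a \<oplus> lam a b\<close>.
\<close>

lemma inv_eq_minus_lam:
  assumes "a \<in> carrier A"
  shows "inv a = \<ominus> lam (inv a) a" "\<ominus> a = lam a (inv a)"
proof -
  have "inv a \<oplus> lam (inv a) a = \<zero>" "a \<oplus> lam a (inv a) = \<zero>"
    using assms by (simp_all add: one_eq_zero flip: mult_eq_add_lam)
  then show "inv a = \<ominus> lam (inv a) a" "\<ominus> a = lam a (inv a)"
    using assms by (simp_all add: minus_equality add.inv_equality a_comm)
qed


section \<open>The socle and its second stage\<close>

lemma mem_socle_iff: "a \<in> socle A \<longleftrightarrow> a \<in> carrier A \<and> (\<forall>x\<in>carrier A. lam a x = x)"
  by (auto simp: socle_def star_eq_zero_iff cong: conj_cong)

lemma socle_carrier [simp]: "a \<in> socle A \<Longrightarrow> a \<in> carrier A"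
  by (simp add: mem_socle_iff)

lemma lam_socle_left [simp]: "\<lbrakk>a \<in> socle A; x \<in> carrier A\<rbrakk> \<Longrightarrow> lam a x = x"
  using mem_socle_iff by blast

lemma socle_mult: "\<lbrakk>a \<in> socle A; x \<in> carrier A\<rbrakk> \<Longrightarrow> a \<otimes> x = a \<oplus> x"
  by (simp add: mult_eq_add_lam)

lemma socle_inv: "a \<in> socle A \<Longrightarrow> inv a = \<ominus> a"
  by (metis inv_eq_minus_lam(2) lam_socle_left socle_carrier inv_closed)

text \<open>The action of an element depends only on its additive coset modulo the socle.\<close>

lemma lam_socle_add:
  "\<lbrakk>s \<in> socle A; a \<in> carrier A; x \<in> carrier A\<rbrakk> \<Longrightarrow> lam (s \<oplus> a) x = lam a x"
  by (simp add: lam_mult flip: socle_mult)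

lemma subgroup_socle: "subgroup (socle A) (add_monoid A)"
proof (rule add.subgroupI)
  show "socle A \<subseteq> carrier A" "socle A \<noteq> {}"
    using mem_socle_iff[of \<zero>] by auto
next
  fix a assume "a \<in> socle A"
  moreover from this have "lam (inv a) x = x" if "x \<in> carrier A" for x
    using that lam_inv_cancel(1)[of a x] by simp
  ultimately show "\<ominus> a \<in> socle A"
    using mem_socle_iff[of "inv a"] by (simp add: socle_inv)
next
  fix a b assume "a \<in> socle A" "b \<in> socle A"
  then show "a \<oplus> b \<in> socle A"
    using mem_socle_iff[of "a \<oplus> b"] by (simp add: lam_socle_add)
qed

lemmas socle_add_closed = subgroup.m_closed[OF subgroup_socle, simplified]
lemmas socle_minus_closed = subgroup.m_inv_closed[OF subgroup_socle, folded a_inv_def, simplified]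
lemmas socle_int_mult_closed = add.subgroup_int_pow_closed[OF subgroup_socle]

lemma subbrace_subset_socle:
  assumes "subgroup H (add_monoid A)" "H \<subseteq> socle A"
  shows "subbrace H A"
  unfolding subbrace_def
proof (intro conjI)
  show "subgroup H (add_monoid A)"
    by fact
  have add: "a \<oplus> b \<in> H" "\<ominus> a \<in> H" "\<zero> \<in> H" if "a \<in> H" "b \<in> H" for a b
    using subgroup.m_closed[OF assms(1)] subgroup.m_inv_closed[OF assms(1)]
      subgroup.one_closed[OF assms(1)] that by (auto simp: a_inv_def)
  show "subgroup H A"
  proof (rule subgroupI)
    show "H \<subseteq> carrier A" "H \<noteq> {}"
      using assms subgroup.one_closed[OF assms(1)] by auto
    fix a b assume "a \<in> H" "b \<in> H"
    then show "inv a \<in> H" "a \<otimes> b \<in> H"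
      using assms(2) add by (auto simp: socle_inv socle_mult subset_iff)
  qed
qed

text \<open>
  This is the second term of the socle series, described by representatives instead of cosets; see
  \<open>socle_step_eq\<close>.
\<close>

definition second_socle :: "'a set" where
  "second_socle = {a \<in> carrier A. \<forall>b\<in>carrier A. star A a b \<in> socle A}"

lemma second_socle_carrier [simp]: "a \<in> second_socle \<Longrightarrow> a \<in> carrier A"
  by (simp add: second_socle_def)

lemma second_socleI:
  "\<lbrakk>a \<in> carrier A; \<And>b. b \<in> carrier A \<Longrightarrow> star A a b \<in> socle A\<rbrakk> \<Longrightarrow> a \<in> second_socle"
  unfolding second_socle_def by blast

lemma star_second_socle: "\<lbrakk>a \<in> second_socle; b \<in> carrier A\<rbrakk> \<Longrightarrow> star A a b \<in> socle A"
  unfolding second_socle_def by blast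

lemma socle_subset_second_socle: "a \<in> socle A \<Longrightarrow> a \<in> second_socle"
  using subgroup.one_closed[OF subgroup_socle]
  by (auto intro!: second_socleI simp: star_eq_zero_iff[THEN iffD2])

text \<open>
  The products \<open>a \<otimes> b\<close> and \<open>a \<oplus> b\<close> differ by \<open>star A a b\<close>, which lies in the socle and acts trivially.
  Hence on the second socle \<open>lam\<close> turns sums into composites.
\<close>

lemma lam_second_socle_add:
  assumes "a \<in> second_socle" "b \<in> carrier A" "c \<in> carrier A"
  shows "lam (a \<oplus> b) c = lam a (lam b c)"
proof -
  have "a \<otimes> b = star A a b \<oplus> (a \<oplus> b)"
    using assms by (simp add: mult_eq_add_lam lam_eq_add_star a_ac)
  then have "lam (a \<oplus> b) c = lam (a \<otimes> b) c"
    using assms by (simp add: lam_socle_add star_second_socle)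
  then show ?thesis
    using assms by (simp add: lam_mult)
qed

lemma lam_second_socle_minus:
  assumes "a \<in> second_socle" "c \<in> carrier A"
  shows "lam (\<ominus> a) c = lam (inv a) c"
proof -
  have "\<ominus> a = star A a (inv a) \<oplus> inv a"
    using assms by (simp add: inv_eq_minus_lam(2) lam_eq_add_star a_comm)
  then show ?thesis
    using assms by (simp add: lam_socle_add star_second_socle)
qed

lemma subgroup_second_socle: "subgroup second_socle (add_monoid A)"
proof (rule add.subgroupI)
  show "second_socle \<subseteq> carrier A" "second_socle \<noteq> {}"
    using socle_subset_second_socle[of \<zero>] subgroup.one_closed[OF subgroup_socle] by auto
next
  fix a assume a: "a \<in> second_socle"
  have "star A (\<ominus> a) b \<in> socle A" if b: "b \<in> carrier A" for b
  proof -
    let ?c = "lam (inv a) b"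
    have "star A (\<ominus> a) b = \<ominus> star A a ?c"
      using a b by (simp add: star_eq_lam lam_second_socle_minus a_minus_def minus_add a_comm)
    then show ?thesis
      using a b by (simp add: star_second_socle socle_minus_closed)
  qed
  then show "\<ominus> a \<in> second_socle"
    using a by (auto intro: second_socleI)
next
  fix a b assume ab: "a \<in> second_socle" "b \<in> second_socle"
  have "star A (a \<oplus> b) c \<in> socle A" if c: "c \<in> carrier A" for c
  proof -
    have "star A (a \<oplus> b) c = star A a (lam b c) \<oplus> star A b c"
      using ab c by (simp add: star_eq_lam lam_second_socle_add a_minus_def a_assoc r_neg1)
    then show ?thesis
      using ab c by (simp add: star_second_socle socle_add_closed)
  qed
  then show "a \<oplus> b \<in> second_socle"
    using ab by (auto intro: second_socleI)
qed

lemmas second_socle_int_mult_closed = add.subgroup_int_pow_closed[OF subgroup_second_socle]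

lemma lam_second_socle_mult:
  assumes "a \<in> second_socle" "c \<in> carrier A"
  shows "lam ([(int n)] \<cdot> a) c = (lam a ^^ n) c"
proof (induction n)
  case 0
  then show ?case
    using assms by simp
next
  case (Suc n)
  have "[(int (Suc n))] \<cdot> a = a \<oplus> [(int n)] \<cdot> a"
    using assms by (simp add: add.int_pow_mult)
  then show ?case
    using assms Suc by (simp add: lam_second_socle_add)
qed


section \<open>Subbraces of the second socle\<close>

definition int_span :: "'a \<Rightarrow> 'a \<Rightarrow> 'a set" where
  "int_span a b = {[k] \<cdot> a \<oplus> [l] \<cdot> b | (k::int) (l::int). True}"

lemma int_spanI [intro]: "[(k::int)] \<cdot> a \<oplus> [(l::int)] \<cdot> b \<in> int_span a b"
  unfolding int_span_def by blast

lemma int_spanE [elim]: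
  assumes "x \<in> int_span a b"
  obtains k l :: int where "x = [k] \<cdot> a \<oplus> [l] \<cdot> b"
  using assms unfolding int_span_def by blast

lemma int_span_generators:
  assumes "a \<in> carrier A" "b \<in> carrier A"
  shows "a \<in> int_span a b" "b \<in> int_span a b"
  using int_spanI[of 1 a 0 b] int_spanI[of 0 a 1 b] assms by simp_all

lemma subgroup_int_span:
  assumes "a \<in> carrier A" "b \<in> carrier A"
  shows "subgroup (int_span a b) (add_monoid A)"
proof (rule add.subgroupI)
  show "int_span a b \<subseteq> carrier A" "int_span a b \<noteq> {}"
    using assms by auto
next
  fix x assume "x \<in> int_span a b"
  then obtain k l :: int where "x = [k] \<cdot> a \<oplus> [l] \<cdot> b"
    by auto
  then have "\<ominus> x = [(- k)] \<cdot> a \<oplus> [(- l)] \<cdot> b"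
    using assms by (simp add: add.int_pow_neg minus_add a_comm)
  then show "\<ominus> x \<in> int_span a b"
    by auto
next
  fix x y assume "x \<in> int_span a b" "y \<in> int_span a b"
  then obtain k l k' l' :: int
    where "x = [k] \<cdot> a \<oplus> [l] \<cdot> b" "y = [k'] \<cdot> a \<oplus> [l'] \<cdot> b"
    by (elim int_spanE) blast
  then have "x \<oplus> y = [(k + k')] \<cdot> a \<oplus> [(l + l')] \<cdot> b"
    using assms by (simp add: add.int_pow_mult a_ac)
  then show "x \<oplus> y \<in> int_span a b"
    by auto
qed

text \<open>
  Multiplicative inverses stay in \<open>M\<close> because within the second socle \<open>inv x = \<ominus> lam (\<ominus> x) x\<close>, where
  \<open>\<ominus> x\<close> is again in \<open>M\<close>.
\<close>

lemma subbrace_second_socle: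
  assumes M: "subgroup M (add_monoid A)" "M \<subseteq> second_socle"
    and lam: "\<And>x y. \<lbrakk>x \<in> M; y \<in> M\<rbrakk> \<Longrightarrow> lam x y \<in> M"
  shows "subbrace M A"
  unfolding subbrace_def
proof (intro conjI)
  show "subgroup M (add_monoid A)"
    by fact
  have minus: "\<ominus> x \<in> M" if "x \<in> M" for x
    using subgroup.m_inv_closed[OF M(1)] that by (simp add: a_inv_def)
  show "subgroup M A"
  proof (rule subgroupI)
    show "M \<subseteq> carrier A" "M \<noteq> {}"
      using M subgroup.one_closed[OF M(1)] by auto
    fix x assume x: "x \<in> M"
    then have "inv x = \<ominus> lam (\<ominus> x) x"
      using M(2) by (metis inv_eq_minus_lam(1) lam_second_socle_minus second_socle_carrier subsetD)
    then show "inv x \<in> M"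
      using x by (simp add: minus lam)
    fix y assume y: "y \<in> M"
    then show "x \<otimes> y \<in> M"
      using x M lam subgroup.m_closed[OF M(1)]
      by (simp add: mult_eq_add_lam subset_iff)
  qed
qed

end


section \<open>Dedekind braces with torsion-free socle\<close>

locale torsion_free_dedekind_brace = left_brace +
  assumes dedekind: "dedekind_brace A"
    and torsion_free_socle: "torsion_free ((add_monoid A)\<lparr>carrier := socle A\<rparr>)"
begin

text \<open>Torsion-freeness in the form used below, with integer instead of natural multiples.\<close>

lemma int_mult_socle_eq_zero:
  assumes "x \<in> socle A" "[(k::int)] \<cdot> x = \<zero>"
  shows "k = 0 \<or> x = \<zero>"
proof (rule disjCI)
  assume "x \<noteq> \<zero>"
  have nat: "n = 0" if "[(int n)] \<cdot> x = \<zero>" for n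
  proof -
    have "x [^]\<^bsub>(add_monoid A)\<lparr>carrier := socle A\<rparr>\<^esub> n = \<zero>"
      using that by (simp add: add_pow_def int_pow_int nat_pow_def)
    then show ?thesis
      using torsion_free_socle assms(1) \<open>x \<noteq> \<zero>\<close> by (auto simp: torsion_free_def)
  qed
  have "[(- k)] \<cdot> x = \<zero>"
    using assms by (simp add: add.int_pow_neg)
  then show "k = 0"
    using nat[of "nat k"] nat[of "nat (- k)"] assms(2) by (cases "0 \<le> k") auto
qed

text \<open>
  The cyclic group generated by \<open>x\<close> is an ideal, so \<open>lam a\<close> and its inverse \<open>lam (inv a)\<close> multiply \<open>x\<close>
  by integers \<open>k\<close> and \<open>l\<close>. Torsion-freeness gives \<open>l * k = 1\<close>.
\<close>

lemma lam_socle_right: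
  assumes a: "a \<in> carrier A" and x: "x \<in> socle A"
  shows "lam a x = x \<or> lam a x = \<ominus> x"
proof (cases "x = \<zero>")
  case False
  let ?C = "generate (add_monoid A) {x}"
  have C: "?C = {[k] \<cdot> x | k :: int. True}"
    using add.generate_pow[of x] x by auto
  have "subbrace ?C A"
  proof (rule subbrace_subset_socle)
    show "subgroup ?C (add_monoid A)"
      using add.generate_is_subgroup x by simp
    show "?C \<subseteq> socle A"
      using C x by (auto simp: socle_int_mult_closed)
  qed
  then have ideal: "brace_ideal ?C A"
    using dedekind by (simp add: dedekind_brace_def)
  have mult: "\<exists>k::int. lam b x = [k] \<cdot> x" if b: "b \<in> carrier A" for b
  proof -
    have "x \<in> ?C"
      by (simp add: generate.incl)
    then have "star A b x \<in> ?C"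
      using ideal b by (simp add: brace_ideal_def)
    then obtain k :: int where "star A b x = [k] \<cdot> x"
      using C by auto
    then have "lam b x = [(k + 1)] \<cdot> x"
      using b x by (simp add: lam_eq_add_star add.int_pow_mult a_comm)
    then show ?thesis
      by blast
  qed
  obtain k where k: "lam a x = [(k::int)] \<cdot> x"
    using mult a by blast
  obtain l where l: "lam (inv a) x = [(l::int)] \<cdot> x"
    using mult a by blast
  have "x = lam (inv a) (lam a x)"
    using a x by simp
  also have "\<dots> = [(l * k)] \<cdot> x"
    using a x k l by (simp add: lam_int_mult add.int_pow_pow)
  finally have "[(l * k - 1)] \<cdot> x = \<zero>"
    using x by (simp add: add.int_pow_diff r_neg)
  then have "l * k = 1"
    using int_mult_socle_eq_zero[OF x] False by fastforce
  then have "k = 1 \<or> k = - 1"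
    using zmult_eq_1_iff by auto
  then show ?thesis
    using k x by (auto simp: add.int_pow_neg)
qed (use a in simp)

text \<open>
  The integer span of \<open>a\<close> and \<open>star A a a\<close> is the subbrace generated by \<open>a\<close>. It is an ideal by the
  Dedekind property, and therefore absorbs \<open>star A a b\<close>.
\<close>

lemma star_mem_int_span:
  assumes a: "a \<in> second_socle" and b: "b \<in> carrier A"
  obtains k l :: int where "star A a b = [k] \<cdot> a \<oplus> [l] \<cdot> star A a a"
proof -
  let ?s = "star A a a"
  let ?M = "int_span a ?s"
  have s: "?s \<in> socle A" "?s \<in> carrier A"
    using a by (simp_all add: star_second_socle)
  have M: "subgroup ?M (add_monoid A)"
    by (rule subgroup_int_span) (use a s in simp_all)
  note M_add = subgroup.m_closed[OF M, simplified]
    and M_minus = subgroup.m_inv_closed[OF M, folded a_inv_def]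
    and M_int_mult = add.subgroup_int_pow_closed[OF M]
  have M_second: "?M \<subseteq> second_socle"
    using a s subgroup.m_closed[OF subgroup_second_socle]
    by (auto simp: second_socle_int_mult_closed socle_subset_second_socle)
  have aM: "a \<in> ?M" and sM: "?s \<in> ?M"
    using int_span_generators a s by simp_all
  \<comment> \<open>The span is a subbrace once its elements act on it. Those elements of the second socle that
    do are closed under addition, so it is enough to place \<open>a\<close>, \<open>\<ominus> a\<close> and the socle among them;
    and an element acts on the span as soon as it maps \<open>a\<close> into it, since on the other generator it
    acts by a sign.\<close>
  define stab where "stab = {x \<in> second_socle. \<forall>y\<in>?M. lam x y \<in> ?M}"
  have stabI: "x \<in> stab" if "x \<in> second_socle" "lam x a \<in> ?M" for x
  proof -
    have "lam x ?s \<in> ?M"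
      using lam_socle_right[OF second_socle_carrier[OF that(1)] s(1)] sM M_minus[OF sM] by metis
    then have "lam x ([k] \<cdot> a \<oplus> [l] \<cdot> ?s) \<in> ?M" for k l :: int
      using that M_add[OF M_int_mult M_int_mult] a s by (simp add: lam_add lam_int_mult)
    then show ?thesis
      using that by (auto simp: stab_def)
  qed
  have stab_add: "x \<oplus> y \<in> stab" if "x \<in> stab" "y \<in> stab" for x y
  proof -
    have "lam (x \<oplus> y) z \<in> ?M" if z: "z \<in> ?M" for z
    proof -
      have "z \<in> carrier A"
        using z subgroup.subset[OF M] by auto
      then have "lam (x \<oplus> y) z = lam x (lam y z)"
        using \<open>x \<in> stab\<close> \<open>y \<in> stab\<close> by (simp add: stab_def lam_second_socle_add)
      then show ?thesis
        using \<open>x \<in> stab\<close> \<open>y \<in> stab\<close> z by (simp add: stab_def)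
    qed
    then show ?thesis
      using that subgroup.m_closed[OF subgroup_second_socle] by (simp add: stab_def)
  qed
  have stab_socle: "x \<in> stab" if "x \<in> socle A" for x
    using that aM a by (intro stabI) (simp_all add: socle_subset_second_socle)
  have stab_mult: "[(int n)] \<cdot> x \<in> stab" if x: "x \<in> stab" for x n
  proof (induction n)
    case 0
    have "\<zero> \<in> stab"
      using stab_socle subgroup.one_closed[OF subgroup_socle] by simp
    then show ?case
      by simp
  next
    case (Suc n)
    have "x \<in> carrier A"
      using x by (simp add: stab_def)
    then have "[(int (Suc n))] \<cdot> x = x \<oplus> [(int n)] \<cdot> x"
      by (simp add: add.int_pow_mult)
    then show ?case
      using x Suc by (simp add: stab_add)
  qed
  have "lam a a \<in> ?M"
    using M_add[OF aM sM] a by (simp add: lam_eq_add_star)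
  then have a_stab: "a \<in> stab"
    by (rule stabI[OF a])
  have minus_a: "\<ominus> a \<in> second_socle"
    using a subgroup.m_inv_closed[OF subgroup_second_socle] by (simp add: a_inv_def)
  have "a = lam (\<ominus> a) (lam a a)"
    using a by (simp add: lam_second_socle_minus)
  also have "\<dots> = lam (\<ominus> a) a \<oplus> lam (\<ominus> a) ?s"
    using a s by (simp add: lam_eq_add_star[of a a] lam_add)
  finally have "lam (\<ominus> a) a = a \<oplus> \<ominus> lam (\<ominus> a) ?s"
    using a s by (metis a_closed a_inv_closed add.inv_solve_right lam_closed second_socle_carrier)
  moreover have "lam (\<ominus> a) ?s \<in> ?M"
    using lam_socle_right[OF second_socle_carrier[OF minus_a] s(1)] sM M_minus[OF sM] by metis
  ultimately have "lam (\<ominus> a) a \<in> ?M"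
    using M_add[OF aM M_minus] by presburger
  then have minus_a_stab: "\<ominus> a \<in> stab"
    by (rule stabI[OF minus_a])
  have a_mult_stab: "[k] \<cdot> a \<in> stab" for k :: int
  proof (cases "0 \<le> k")
    case True
    then show ?thesis
      using stab_mult[OF a_stab, of "nat k"] by simp
  next
    case False
    then have "[k] \<cdot> a = [(int (nat (- k)))] \<cdot> (\<ominus> a)"
      using a by (simp add: add.int_pow_inv add.int_pow_neg)
    then show ?thesis
      using stab_mult[OF minus_a_stab, of "nat (- k)"] by (simp only:)
  qed
  have M_stab: "?M \<subseteq> stab"
    using a_mult_stab stab_socle s by (auto intro!: stab_add simp: socle_int_mult_closed)
  have "subbrace ?M A"
  proof (rule subbrace_second_socle[OF M M_second])
    fix x y
    assume "x \<in> ?M" "y \<in> ?M"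
    then show "lam x y \<in> ?M"
      using M_stab unfolding stab_def by blast
  qed
  then have "brace_ideal ?M A"
    using dedekind by (simp add: dedekind_brace_def)
  then have "star A a b \<in> ?M"
    using aM b by (simp add: brace_ideal_def)
  then show ?thesis
    by (rule int_spanE) (rule that)
qed

text \<open>
  If \<open>lam a\<close> fixes \<open>star A a c\<close>, then its \<open>m\<close>-th power translates \<open>c\<close> by \<open>m\<close> times \<open>star A a c\<close>. The
  \<open>n\<close>-th power is the action of \<open>n\<close> times \<open>a\<close>, which is trivial, so \<open>n\<close> times \<open>star A a c\<close> is zero.
\<close>

lemma int_mult_star_fixed:
  assumes a: "a \<in> second_socle" and c: "c \<in> carrier A"
    and na: "[(int n)] \<cdot> a \<in> socle A"
    and fixed: "lam a (star A a c) = star A a c"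
  shows "n = 0 \<or> star A a c = \<zero>"
proof -
  have "(lam a ^^ m) c = c \<oplus> [(int m)] \<cdot> star A a c" for m
  proof (induction m)
    case 0
    then show ?case
      using c by simp
  next
    case (Suc m)
    then have "(lam a ^^ Suc m) c = c \<oplus> star A a c \<oplus> [(int m)] \<cdot> star A a c"
      using a c fixed by (simp add: lam_add lam_int_mult lam_eq_add_star[of a c])
    also have "\<dots> = c \<oplus> [(int (Suc m))] \<cdot> star A a c"
      using a c by (simp add: add.int_pow_mult a_assoc)
    finally show ?case .
  qed
  then have "c \<oplus> [(int n)] \<cdot> star A a c = c"
    using lam_second_socle_mult[OF a c, of n] na c by simp
  then have "[(int n)] \<cdot> star A a c = \<zero>"
    using a c by simp
  then show ?thesis
    using int_mult_socle_eq_zero star_second_socle[OF a c] by (metis of_nat_eq_0_iff)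
qed

text \<open>
  Write \<open>s = star A a a\<close>. If \<open>lam a\<close> fixes \<open>s\<close>, no nonzero multiple of \<open>a\<close> is in the socle. Suppose
  that it negates \<open>s\<close>, and that \<open>n a\<close> is in the socle with \<open>n > 0\<close>. Then \<open>n\<close> is even, because the
  \<open>n\<close>-th power of \<open>lam a\<close> is trivial. Moreover \<open>lam a\<close> sends \<open>n a\<close> to \<open>n a \<oplus> n s\<close>, which must
  be \<open>n a\<close> or \<open>\<ominus> n a\<close>; the first would give \<open>n s = 0\<close>, and the second gives \<open>n a = \<ominus> (n / 2) s\<close>
  after division by two. The model for this case is the brace on the integers with product
  \<open>a + (- 1) ^ a * b\<close> and \<open>a = 1\<close>, where \<open>s = - 2\<close>.
\<close>

lemma int_mult_in_socle_multiple_of_star_self: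
  assumes a: "a \<in> second_socle" and s: "star A a a \<noteq> \<zero>"
    and na: "[(int n)] \<cdot> a \<in> socle A"
  obtains m :: int where "[(int n)] \<cdot> a = [m] \<cdot> star A a a"
proof -
  let ?s = "star A a a"
  have sS: "?s \<in> socle A" "?s \<in> carrier A"
    using a by (simp_all add: star_second_socle)
  have n0: thesis if "n = 0"
    by (rule \<open>\<And>m. [(int n)] \<cdot> a = [m] \<cdot> ?s \<Longrightarrow> thesis\<close>[of 0]) (simp add: that)
  consider "lam a ?s = ?s" | "lam a ?s = \<ominus> ?s"
    using lam_socle_right[OF second_socle_carrier[OF a] sS(1)] by blast
  then show ?thesis
  proof cases
    case 1
    then show ?thesis
      using int_mult_star_fixed[OF a second_socle_carrier[OF a] na 1] s n0 by blast
  next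
    case 2
    have "lam a ([(int n)] \<cdot> a) = [(int n)] \<cdot> a \<oplus> [(int n)] \<cdot> ?s"
      using a by (simp add: lam_eq_add_star star_int_mult)
    then consider "[(int n)] \<cdot> a \<oplus> [(int n)] \<cdot> ?s = [(int n)] \<cdot> a"
      | "[(int n)] \<cdot> a \<oplus> [(int n)] \<cdot> ?s = \<ominus> ([(int n)] \<cdot> a)"
      using lam_socle_right[OF _ na, of a] a by auto
    then show ?thesis
    proof cases
      case 1
      then have "[(int n)] \<cdot> ?s = \<zero>"
        using a sS by simp
      then show ?thesis
        using int_mult_socle_eq_zero[OF sS(1)] s n0 by (metis of_nat_eq_0_iff)
    next
      case neg: 2
      have alt: "(lam a ^^ m) ?s = (if even m then ?s else \<ominus> ?s)" for m
        by (induction m) (use a sS 2 in \<open>auto simp: lam_minus\<close>)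
      have "even n"
      proof (rule ccontr)
        assume "odd n"
        then have "?s = \<ominus> ?s"
          using alt lam_second_socle_mult[OF a sS(2), of n] na sS by simp
        then have "?s \<oplus> ?s = \<zero>"
          using sS(2) by (metis r_neg)
        then have "[(2::int)] \<cdot> ?s = \<zero>"
          using sS add.int_pow_mult[of ?s 1 1] by simp
        then show False
          using int_mult_socle_eq_zero[OF sS(1)] s by (metis zero_neq_numeral)
      qed
      then obtain m where m: "n = 2 * m"
        by blast
      \<comment> \<open>Half of the relation \<open>2 n a \<oplus> n s = 0\<close>.\<close>
      let ?w = "[(int n)] \<cdot> a \<oplus> [(int m)] \<cdot> ?s"
      have "?w \<in> socle A"
        using na sS by (simp add: socle_add_closed socle_int_mult_closed)
      moreover have "[(2::int)] \<cdot> ?w = [(int n)] \<cdot> a \<oplus> ([(int n)] \<cdot> a \<oplus> [(int n)] \<cdot> ?s)"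
        using a sS add.int_pow_mult[of "[(int n)] \<cdot> a" 1 1]
        by (simp add: add.int_pow_distrib add.int_pow_pow m a_assoc mult.commute)
      then have "[(2::int)] \<cdot> ?w = \<zero>"
        using neg a by (simp add: r_neg)
      ultimately have "?w = \<zero>"
        using int_mult_socle_eq_zero by (metis zero_neq_numeral)
      then have "[(int n)] \<cdot> a = [(- int m)] \<cdot> ?s"
        using a sS by (simp add: add.int_pow_neg minus_equality)
      then show ?thesis
        by (rule that)
    qed
  qed
qed

text \<open>
  Since \<open>star A a b\<close> is a combination \<open>k a \<oplus> l s\<close> with \<open>s = star A a a\<close>, and it and \<open>s\<close> are in the
  socle, so is \<open>k a\<close>. If \<open>s \<noteq> 0\<close>, then \<open>k a\<close> is a multiple of \<open>s\<close> by the previous lemma. If \<open>s = 0\<close>,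
  then \<open>lam a\<close> fixes \<open>a\<close>, hence also \<open>star A a b = k a\<close>, which is then zero by
  \<open>int_mult_star_fixed\<close>.
\<close>

lemma star_multiple_of_star_self:
  assumes a: "a \<in> second_socle" and b: "b \<in> carrier A"
  obtains k :: int where "star A a b = [k] \<cdot> star A a a"
proof -
  let ?s = "star A a a" and ?t = "star A a b"
  have s: "?s \<in> socle A" "?s \<in> carrier A" and t: "?t \<in> socle A" "?t \<in> carrier A"
    using a b by (simp_all add: star_second_socle)
  obtain k l :: int where kl: "?t = [k] \<cdot> a \<oplus> [l] \<cdot> ?s"
    using star_mem_int_span[OF a b] .
  then have "[k] \<cdot> a = ?t \<oplus> [(- l)] \<cdot> ?s"
    using a s t by (simp add: add.int_pow_neg a_assoc r_neg)
  then have ka: "[k] \<cdot> a \<in> socle A"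
    using s t by (simp add: socle_add_closed socle_int_mult_closed)
  \<comment> \<open>Powers of \<open>lam a\<close> have natural exponents, so the sign of \<open>k\<close> is split off.\<close>
  define n where "n = nat \<bar>k\<bar>"
  have n: "[(int n)] \<cdot> a = [k] \<cdot> a \<or> [(int n)] \<cdot> a = \<ominus> ([k] \<cdot> a)"
    using a by (auto simp: n_def abs_if add.int_pow_neg)
  then have na: "[(int n)] \<cdot> a \<in> socle A"
    using ka by (auto simp: socle_minus_closed)
  show ?thesis
  proof (cases "?s = \<zero>")
    case True
    then have "?t = [k] \<cdot> a"
      using kl a by simp
    moreover have "lam a a = a"
      using a True by (simp add: lam_eq_add_star)
    ultimately have "lam a ?t = ?t"
      using a by (simp add: lam_int_mult)
    then have "n = 0 \<or> ?t = \<zero>"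
      using int_mult_star_fixed[OF a b na] by simp
    then have "?t = \<zero>"
      using \<open>?t = [k] \<cdot> a\<close> by (auto simp: n_def)
    then show ?thesis
      using that[of 0] by simp
  next
    case False
    obtain m :: int where m: "[(int n)] \<cdot> a = [m] \<cdot> ?s"
      using int_mult_in_socle_multiple_of_star_self[OF a False na] .
    obtain m' :: int where "[k] \<cdot> a = [m'] \<cdot> ?s"
    proof (cases "[(int n)] \<cdot> a = [k] \<cdot> a")
      case True
      with m have "[k] \<cdot> a = [m] \<cdot> ?s"
        by simp
      then show ?thesis
        by (rule that)
    next
      case False
      then have "[k] \<cdot> a = \<ominus> ([(int n)] \<cdot> a)"
        using n a by auto
      also have "\<dots> = [(- m)] \<cdot> ?s"
        using m s by (simp add: add.int_pow_neg)
      finally show ?thesis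
        by (rule that)
    qed
    then have "?t = [(m' + l)] \<cdot> ?s"
      using kl s by (simp add: add.int_pow_mult)
    then show ?thesis
      by (rule that)
  qed
qed

text \<open>
  For \<open>c = n a\<close>, additivity of \<open>lam c\<close> makes \<open>star A c c\<close> the \<open>n\<close>-fold of \<open>star A c a\<close>. But \<open>star A c a\<close>
  is a multiple of \<open>star A c c\<close>, so it is a multiple of its own \<open>n\<close>-fold, hence zero.
\<close>

lemma lam_pow_self:
  assumes a: "a \<in> second_socle" and n: "2 \<le> n"
  shows "(lam a ^^ n) a = a"
proof -
  let ?c = "[(int n)] \<cdot> a"
  have c: "?c \<in> second_socle"
    using a by (rule second_socle_int_mult_closed)
  have d: "star A ?c a \<in> socle A" "star A ?c a \<in> carrier A"
    using a c by (simp_all add: star_second_socle)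
  obtain k :: int where "star A ?c a = [k] \<cdot> star A ?c ?c"
    by (rule star_multiple_of_star_self[OF c second_socle_carrier[OF a]])
  also have "\<dots> = [(int n * k)] \<cdot> star A ?c a"
    using a c d by (simp add: star_int_mult add.int_pow_pow)
  finally have "[(int n * k - 1)] \<cdot> star A ?c a = \<zero>"
    using d by (simp add: add.int_pow_diff r_neg)
  moreover have "int n * k \<noteq> 1"
    using n by (auto simp: zmult_eq_1_iff)
  ultimately have "star A ?c a = \<zero>"
    using int_mult_socle_eq_zero[OF d(1)] by (metis eq_iff_diff_eq_0)
  then have "lam ?c a = a"
    using a c by (simp add: lam_eq_add_star)
  then show ?thesis
    using lam_second_socle_mult[OF a, of a n] a by simp
qed

lemma second_socle_eq_socle: "second_socle = socle A"
proof
  show "socle A \<subseteq> second_socle"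
    by (auto simp: socle_subset_second_socle)
  show "second_socle \<subseteq> socle A"
  proof
    fix a assume a: "a \<in> second_socle"
    \<comment> \<open>The square and the cube of \<open>lam a\<close> both fix \<open>a\<close>, hence so does \<open>lam a\<close>.\<close>
    have "lam a a = a"
      using lam_pow_self[OF a, of 2] lam_pow_self[OF a, of 3] by (simp add: numeral_eq_Suc)
    then have "star A a a = \<zero>"
      using a by (simp add: star_eq_zero_iff)
    then have "star A a b = \<zero>" if "b \<in> carrier A" for b
      using star_multiple_of_star_self[OF a that] by (metis add.int_pow_one)
    then show "a \<in> socle A"
      using second_socle_carrier[OF a] unfolding socle_def by blast
  qed
qed

end


section \<open>The socle of a quotient brace\<close>

context left_brace
begin

lemma abelian_subgroup_brace_ideal: "brace_ideal I A \<Longrightarrow> abelian_subgroup I A"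
  by (simp add: abelian_subgroupI2 a_comm_group brace_ideal_def subbrace_def)

text \<open>
  An element \<open>i \<oplus> a\<close> of the additive coset is \<open>a \<otimes> i'\<close> with \<open>i' = lam (inv a) i\<close> in \<open>I\<close>. Multiplying
  \<open>b'\<close> by \<open>i'\<close> on the left moves it only within its coset, because the ideal contains \<open>star A i' b'\<close>,
  and \<open>lam a\<close> preserves \<open>I\<close>.
\<close>

lemma brace_ideal_mult_congruent:
  assumes I: "brace_ideal I A"
    and a: "a \<in> carrier A" "a' \<in> I +> a" and b: "b \<in> carrier A" "b' \<in> I +> b"
  shows "a' \<otimes> b' \<in> I +> (a \<otimes> b)"
proof -
  interpret I: abelian_subgroup I A
    by (rule abelian_subgroup_brace_ideal[OF I])
  have lam_I: "lam x i \<in> I" if "x \<in> carrier A" "i \<in> I" for x i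
    using I that I.a_closed I.a_Hcarr by (simp add: lam_eq_add_star brace_ideal_def)
  obtain i where i: "i \<in> I" "a' = i \<oplus> a"
    using a(2) by (auto simp: a_r_coset_def')
  obtain j where j: "j \<in> I" "b' = j \<oplus> b"
    using b(2) by (auto simp: a_r_coset_def')
  have c: "i \<in> carrier A" "j \<in> carrier A" "b' \<in> carrier A"
    using i j b I.a_Hcarr by auto
  define i' where "i' = lam (inv a) i"
  have i': "i' \<in> I" "i' \<in> carrier A"
    using i a lam_I I.a_Hcarr by (auto simp: i'_def)
  have "a' = a \<otimes> i'"
    using a c by (simp add: i(2) i'_def mult_eq_add_lam a_comm)
  then have "a' \<otimes> b' = a \<otimes> (i' \<oplus> lam i' b')"
    using a c i' by (simp add: m_assoc flip: mult_eq_add_lam)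
  also have "i' \<oplus> lam i' b' = (i' \<oplus> star A i' b' \<oplus> j) \<oplus> b"
    using b c i' by (simp add: lam_eq_add_star j(2) a_ac)
  also have "a \<otimes> \<dots> = lam a (i' \<oplus> star A i' b' \<oplus> j) \<oplus> a \<otimes> b"
    using a b c i' by (simp add: mult_eq_add_lam lam_add a_ac)
  finally have "a' \<otimes> b' = lam a (i' \<oplus> star A i' b' \<oplus> j) \<oplus> a \<otimes> b" .
  moreover have "lam a (i' \<oplus> star A i' b' \<oplus> j) \<in> I"
    using I a c i' j by (intro lam_I I.a_closed) (auto simp: brace_ideal_def)
  ultimately show ?thesis
    by (auto simp: a_r_coset_def')
qed

lemma star_Quot:
  assumes I: "brace_ideal I A" and ab: "a \<in> carrier A" "b \<in> carrier A"
  shows "star (A Quot I) (I +> a) (I +> b) = I +> star A a b"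
proof -
  interpret I: abelian_subgroup I A
    by (rule abelian_subgroup_brace_ideal[OF I])
  have add_Quot: "add_monoid (A Quot I) = A A_Mod I"
    by (simp add: FactRing_def A_FactGroup_def FactGroup_def A_RCOSETS_def set_add_def)
  have coset: "I +> x \<in> carrier (A A_Mod I)" if "x \<in> carrier A" for x
    using that a_rcosetsI[OF I.a_subset] by (simp add: A_FactGroup_def FactGroup_def A_RCOSETS_def)
  have "\<ominus>\<^bsub>A Quot I\<^esub> (I +> x) = I +> (\<ominus> x)" if "x \<in> carrier A" for x
    unfolding a_inv_def[of "A Quot I"] add_Quot
    using I.a_inv_FactGroup[OF coset[OF that]] I.a_rcos_inv[OF that] by simp
  then have minus: "Y \<ominus>\<^bsub>A Quot I\<^esub> (I +> x) = Y <+> (I +> (\<ominus> x))"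
    if "x \<in> carrier A" for Y x
    using that by (simp add: a_minus_def) (simp add: FactRing_def)
  have "(I +> a) \<otimes>\<^bsub>A Quot I\<^esub> (I +> b) = I +> (a \<otimes> b)"
  proof -
    have "I +> (a' \<otimes> b') = I +> (a \<otimes> b)" if "a' \<in> I +> a" "b' \<in> I +> b" for a' b'
      using I.a_repr_independence'[OF brace_ideal_mult_congruent[OF I ab(1) that(1) ab(2) that(2)]]
        ab by simp
    then have "(I +> a) \<otimes>\<^bsub>A Quot I\<^esub> (I +> b) = (\<Union>a'\<in>I +> a. \<Union>b'\<in>I +> b. I +> (a \<otimes> b))"
      by (simp add: FactRing_def rcoset_mult_def)
    moreover have "I +> a \<noteq> {}" "I +> b \<noteq> {}"
      using I.a_rcos_self[OF ab(1)] I.a_rcos_self[OF ab(2)] by blast+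
    ultimately show ?thesis
      by simp
  qed
  then show ?thesis
    using ab by (simp add: star_def minus I.a_rcos_sum minus_eq)
qed

lemma socle_step_eq:
  assumes I: "brace_ideal I A"
  shows "socle_step A I = {a \<in> carrier A. \<forall>b\<in>carrier A. star A a b \<in> I}"
proof -
  interpret I: abelian_subgroup I A
    by (rule abelian_subgroup_brace_ideal[OF I])
  have carrier_Quot: "carrier (A Quot I) = (\<lambda>x. I +> x) ` carrier A"
    by (auto simp: FactRing_def A_RCOSETS_def')
  have "I +> x = I \<longleftrightarrow> x \<in> I" if "x \<in> carrier A" for x
    using that a_coset_join1[of I x] a_coset_join2[of x I] I.a_subgroup by auto
  then have star: "star (A Quot I) (I +> a) (I +> b) = I \<longleftrightarrow> star A a b \<in> I"
    if "a \<in> carrier A" "b \<in> carrier A" for a b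
    using that by (simp add: star_Quot[OF I])
  have zero_Quot: "\<zero>\<^bsub>A Quot I\<^esub> = I"
    by (simp add: FactRing_def)
  have "I +> a \<in> socle (A Quot I) \<longleftrightarrow> (\<forall>b\<in>carrier A. star A a b \<in> I)"
    if a: "a \<in> carrier A" for a
  proof -
    have "I +> a \<in> socle (A Quot I) \<longleftrightarrow>
        (\<forall>b\<in>carrier A. star (A Quot I) (I +> a) (I +> b) = I)"
      unfolding socle_def carrier_Quot zero_Quot using a by blast
    then show ?thesis
      using star[OF a] by blast
  qed
  then show ?thesis
    unfolding socle_step_def by blast
qed

end


section \<open>Collapse of the socle series\<close>

context torsion_free_dedekind_brace
begin

text \<open>
  The zero term has \<open>{\<zero>}\<close>, one step leads from it to the socle, and a further step stays there. At a
  limit, the terms below include \<open>{\<zero>}\<close>; for this the index must be in the field of \<open>r\<close>, since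
  otherwise nothing precedes it and its term is empty.
\<close>

lemma socle_series_cases:
  assumes r: "Well_order r"
    and i: "i \<in> Field r"
  shows "socle_series A r i = {\<zero>} \<or> socle_series A r i = socle A"
proof -
  interpret wo_rel r
    by (simp add: wo_rel_def r)
  have "brace_ideal I A" if "subgroup I (add_monoid A)" "I \<subseteq> socle A" for I
    using dedekind subbrace_subset_socle[OF that] by (simp add: dedekind_brace_def)
  then have ideal: "brace_ideal {\<zero>} A" "brace_ideal (socle A) A"
    using subgroup_socle subgroup.one_closed[OF subgroup_socle] add.triv_subgroup by simp_all
  have step_zero: "socle_step A {\<zero>} = socle A"
    unfolding socle_step_eq[OF ideal(1)] socle_def by simp
  have step_socle: "socle_step A (socle A) = socle A"
    using second_socle_eq_socle unfolding socle_step_eq[OF ideal(2)] second_socle_def .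
  have "i \<in> Field r \<longrightarrow> ?thesis"
  proof (induction i rule: well_order_inductZSL)
    case Zero
    then show ?case
      by (simp add: socle_series_zero[OF r])
  next
    case (Suc i)
    then have "i \<in> Field r"
      by (auto simp: aboveS_def Field_def)
    with Suc show ?case
      using step_zero step_socle by (auto simp: socle_series_succ[OF r])
  next
    case (Lim i)
    show ?case
    proof
      assume "i \<in> Field r"
      then have "zero \<in> underS i"
        using Lim.hyps zero_smallest by (auto simp: underS_def)
      then have zero: "{\<zero>} \<subseteq> (\<Union>m\<in>underS i. socle_series A r m)"
        using socle_series_zero[OF r, of A] by blast
      have "socle_series A r m = {\<zero>} \<or> socle_series A r m = socle A" if "m \<in> underS i" for m
        using Lim.IH[OF that] that by (auto simp: underS_def Field_def)
      then have "(\<Union>m\<in>underS i. socle_series A r m) = {\<zero>} \<or>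
          (\<Union>m\<in>underS i. socle_series A r m) = socle A"
        using zero subgroup.one_closed[OF subgroup_socle] by fastforce
      then show "socle_series A r i = {\<zero>} \<or> socle_series A r i = socle A"
        using Lim.hyps by (simp add: socle_series_lim[OF r])
    qed
  qed
  then show ?thesis
    using i by simp
qed

lemma socle_infty_subset: "socle_infty A \<subseteq> socle A"
proof -
  have "Well_order (cardSuc (card_of (carrier A)))"
    by (simp add: cardSuc_Card_order card_order_on_well_order_on)
  then have "socle_series A (cardSuc (card_of (carrier A))) \<alpha> \<subseteq> socle A"
    if "\<alpha> \<in> Field (cardSuc (card_of (carrier A)))" for \<alpha>
    using socle_series_cases[OF _ that] subgroup.one_closed[OF subgroup_socle] by auto
  then show ?thesis
    unfolding socle_infty_def Let_def by blast
qed

end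

theorem theorem2:
  fixes A :: "('a, 'm) ring_scheme"
  assumes "left_brace A"
    and "dedekind_brace A"
    and "hypermultipermutational A"
    and "torsion_free ((add_monoid A)\<lparr>carrier := socle A\<rparr>)"
  shows "abelian_brace A"
proof -
  interpret torsion_free_dedekind_brace A
    by (intro torsion_free_dedekind_brace.intro torsion_free_dedekind_brace_axioms.intro assms)
  have "carrier A \<subseteq> socle A"
    using assms(3) socle_infty_subset by (simp add: hypermultipermutational_def)
  then show ?thesis
    unfolding abelian_brace_def socle_def by blast
qed

end
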